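(* There exists $u_0\in C^\infty(\mathbb{T}^3)$ such that the 3-D incompressible Euler system on $\mathbb{T}^3$ has a global strong solution $u(t)$ with initial data $u_0$ whose vorticity $\omega=\nabla\times u$ satisfies $$|\omega(t)|_{L^\infty}\ge e^{t}\qquad\text{for all } t>0.$$
   Context: The 3-D incompressible Euler system is $\partial_t u+(u\cdot\nabla)u+\nabla p=0$, $\mathrm{div}(u)=0$, $u(0)=u_0$. *)

theory Defs
  imports "HOL-Analysis.Analysis" "HOL-Probability.Essential_Supremum"
begin

text \<open>Functions on \<open>\<T>\<^sup>3 = (\<real>/2\<pi>\<int>)\<^sup>3\<close> are functions on \<open>\<real>\<^sup>3\<close> that are \<open>2\<pi>\<close>-periodic in each coordinate.\<close>

definition periodic :: "(real ^ 3 \<Rightarrow> 'a) \<Rightarrow> bool" where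
  "periodic f \<longleftrightarrow> (\<forall>x i. f (x + (2 * pi) *\<^sub>R axis i 1) = f x)"

definition partial :: "3 \<Rightarrow> (real ^ 3 \<Rightarrow> 'a::real_normed_vector) \<Rightarrow> real ^ 3 \<Rightarrow> 'a" where
  "partial i f x = frechet_derivative f (at x) (axis i 1)"

primrec Ck :: "nat \<Rightarrow> (real ^ 3 \<Rightarrow> 'a::real_normed_vector) \<Rightarrow> bool" where
  "Ck 0 f \<longleftrightarrow> continuous_on UNIV f"
| "Ck (Suc k) f \<longleftrightarrow> (\<forall>x. f differentiable (at x)) \<and> (\<forall>i. Ck k (partial i f))"

definition Ck_torus :: "nat \<Rightarrow> (real ^ 3 \<Rightarrow> 'a::real_normed_vector) \<Rightarrow> bool" where
  "Ck_torus k f \<longleftrightarrow> periodic f \<and> Ck k f"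

definition smooth_torus :: "(real ^ 3 \<Rightarrow> 'a::real_normed_vector) \<Rightarrow> bool" where
  "smooth_torus f \<longleftrightarrow> (\<forall>k. Ck_torus k f)"

definition grad :: "(real ^ 3 \<Rightarrow> real) \<Rightarrow> real ^ 3 \<Rightarrow> real ^ 3" where
  "grad p x = (\<chi> i. partial i p x)"

definition div_field :: "(real ^ 3 \<Rightarrow> real ^ 3) \<Rightarrow> real ^ 3 \<Rightarrow> real" where
  "div_field u x = (\<Sum>i\<in>UNIV. partial i u x $ i)"

definition curl :: "(real ^ 3 \<Rightarrow> real ^ 3) \<Rightarrow> real ^ 3 \<Rightarrow> real ^ 3" where
  "curl u x = vector
     [partial 2 u x $ 3 - partial 3 u x $ 2,
      partial 3 u x $ 1 - partial 1 u x $ 3,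
      partial 1 u x $ 2 - partial 2 u x $ 1]"

text \<open>\<open>(v \<cdot> \<nabla>) u\<close>\<close>
definition advect :: "(real ^ 3 \<Rightarrow> real ^ 3) \<Rightarrow> (real ^ 3 \<Rightarrow> real ^ 3) \<Rightarrow> real ^ 3 \<Rightarrow> real ^ 3" where
  "advect v u x = (\<Sum>i\<in>UNIV. (v x $ i) *\<^sub>R partial i u x)"

text \<open>The time derivative on \<open>[0,\<infinity>)\<close>, one-sided at \<open>t = 0\<close>.\<close>
definition time_deriv :: "(real \<Rightarrow> real ^ 3 \<Rightarrow> real ^ 3) \<Rightarrow> real \<Rightarrow> real ^ 3 \<Rightarrow> real ^ 3" where
  "time_deriv u t x = vector_derivative (\<lambda>s. u s x) (at t within {0..})"

text \<open>\<open>u \<in> C\<^sup>1([0,\<infinity>) \<times> \<T>\<^sup>3)\<close>; as the torus is compact, this is the class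
  \<open>C([0,\<infinity>); C\<^sup>1(\<T>\<^sup>3)) \<inter> C\<^sup>1([0,\<infinity>); C(\<T>\<^sup>3))\<close>.\<close>
definition C1_spacetime :: "(real \<Rightarrow> real ^ 3 \<Rightarrow> real ^ 3) \<Rightarrow> bool" where
  "C1_spacetime u \<longleftrightarrow>
     (\<forall>t\<ge>0. periodic (u t)) \<and>
     (\<forall>t\<ge>0. \<forall>x. u t differentiable (at x)) \<and>
     (\<forall>t\<ge>0. \<forall>x. (\<lambda>s. u s x) differentiable (at t within {0..})) \<and>
     continuous_on ({0..} \<times> UNIV) (\<lambda>(t, x). u t x) \<and>
     (\<forall>i. continuous_on ({0..} \<times> UNIV) (\<lambda>(t, x). partial i (u t) x)) \<and>
     continuous_on ({0..} \<times> UNIV) (\<lambda>(t, x). time_deriv u t x)"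

text \<open>A strong solution has all derivatives in the system as continuous functions, and the equations
  hold pointwise. The pressure is a function on the torus too (no mean pressure gradient); continuity
  of \<open>\<nabla>p\<close> in time follows from the momentum equation, and \<open>p\<close> is only determined up to
  a function of time.\<close>
definition global_strong_euler_solution ::
    "(real ^ 3 \<Rightarrow> real ^ 3) \<Rightarrow> (real \<Rightarrow> real ^ 3 \<Rightarrow> real ^ 3) \<Rightarrow> bool" where
  "global_strong_euler_solution u0 u \<longleftrightarrow>
     C1_spacetime u \<and>
     u 0 = u0 \<and>
     (\<exists>p :: real \<Rightarrow> real ^ 3 \<Rightarrow> real. \<forall>t\<ge>0.
        Ck_torus 1 (p t) \<and>
        (\<forall>x. time_deriv u t x + advect (u t) (u t) x + grad (p t) x = 0) \<and>
        (\<forall>x. div_field (u t) x = 0))"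

text \<open>The \<open>L\<^sup>\<infinity>\<close> norm on the torus, computed on a fundamental cell.\<close>
definition Linf_norm :: "(real ^ 3 \<Rightarrow> real ^ 3) \<Rightarrow> ereal" where
  "Linf_norm w = esssup (lebesgue_on (cbox 0 (\<chi> i. 2 * pi))) (\<lambda>x. ereal (norm (w x)))"

end

theory Submission
  imports Defs
begin

text \<open>
  The solution is a two-and-a-half-dimensional flow: a steady planar cellular flow \<open>(u\<^sub>1, u\<^sub>2)\<close>
  that passively transports a third component, \<open>u\<^sub>3(t, x) = sin (X\<^sub>1(t, x))\<close>, where \<open>X\<close> is the flow
  of \<open>(sin x\<^sub>1 cos x\<^sub>2, - cos x\<^sub>1 sin x\<^sub>2, 0) = - (u\<^sub>1, u\<^sub>2, 0)\<close>. The pressure of the planar flow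
  is stationary, so no equation has to be solved for it. At the origin, a hyperbolic stagnation point,
  the linearised flow of \<open>X\<close> expands the first direction by \<open>e\<^sup>t\<close>; hence \<open>\<partial>\<^sub>1 u\<^sub>3(t, 0) = e\<^sup>t\<close>,
  which is a component of the vorticity up to sign.

  The flow \<open>X\<close> is not elementary. It is the limit of the Picard iterates, and the
  iterates of the variational equation converge uniformly along with them, so \<open>X\<close> is continuously
  differentiable. With the exponential weights \<open>e\<^bsup>2Lt\<^esup>\<close> and \<open>e\<^bsup>4Lt\<^esup>\<close> the convergence is geometric with
  ratio \<open>1/2\<close> for all times at once.
\<close>

section \<open>The flow of a bounded vector field with Lipschitz derivative\<close>

text \<open>Integrating the weight exp (k s) gains a factor 1/k, which turns the Lipschitz estimates
  below into contractions. The term -1 is kept because it later absorbs the norm of the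
  identity.\<close>

lemma norm_integral_le_exp:
  fixes f :: "real \<Rightarrow> 'a::banach"
  assumes "0 \<le> t" "k > 0" "continuous_on {0..t} f"
    and le: "\<And>s. 0 \<le> s \<Longrightarrow> s \<le> t \<Longrightarrow> norm (f s) \<le> c * k * exp (k * s)"
  shows "norm (integral {0..t} f) \<le> c * (exp (k * t) - 1)"
proof -
  have "((\<lambda>s. c * k * exp (k * s)) has_integral (c * exp (k * t) - c * exp (k * 0))) {0..t}"
    by (rule fundamental_theorem_of_calculus[OF \<open>0 \<le> t\<close>])
      (auto intro!: derivative_eq_intros simp flip: has_real_derivative_iff_has_vector_derivative)
  moreover have "f integrable_on {0..t}"
    using assms(3) by (rule integrable_continuous_real)
  ultimately have "norm (integral {0..t} f) \<le> c * exp (k * t) - c * exp (k * 0)"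
    by (metis integral_norm_bound_integral has_integral_iff atLeastAtMost_iff le)
  then show ?thesis by (simp add: algebra_simps)
qed

text \<open>Weierstrass M-test for the telescoping series. The limit is written with
  \<open>lim\<close> so that it matches the definitions of \<open>flow\<close> and
  \<open>flow_deriv\<close>.\<close>

lemma uniform_limit_geometric:
  fixes f :: "nat \<Rightarrow> 'b \<Rightarrow> 'a::banach"
  assumes "\<And>n z. z \<in> A \<Longrightarrow> norm (f (Suc n) z - f n z) \<le> C * (1/2) ^ n"
  shows "uniform_limit A f (\<lambda>z. lim (\<lambda>n. f n z)) sequentially"
proof -
  have "uniform_limit A (\<lambda>n z. \<Sum>i<n. f (Suc i) z - f i z) (\<lambda>z. suminf (\<lambda>i. f (Suc i) z - f i z)) sequentially"
    by (rule Weierstrass_m_test[where M = "\<lambda>n. C * (1/2) ^ n"])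
      (use assms in \<open>auto intro!: summable_mult summable_geometric\<close>)
  then have "uniform_limit A (\<lambda>n z. f n z - f 0 z) (\<lambda>z. suminf (\<lambda>i. f (Suc i) z - f i z)) sequentially"
    by (subst (asm) sum_lessThan_telescope)
  then have "uniform_limit A (\<lambda>n z. f n z - f 0 z + f 0 z)
      (\<lambda>z. suminf (\<lambda>i. f (Suc i) z - f i z) + f 0 z) sequentially"
    by (rule uniform_limit_add) (auto simp: uniform_limit_iff)
  then have u: "uniform_limit A f (\<lambda>z. suminf (\<lambda>i. f (Suc i) z - f i z) + f 0 z) sequentially"
    by simp
  have "suminf (\<lambda>i. f (Suc i) z - f i z) + f 0 z = lim (\<lambda>n. f n z)" if "z \<in> A" for z
    using tendsto_uniform_limitI[OF u that] by (simp add: limI)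
  with u show ?thesis
    unfolding uniform_limit_iff by simp
qed

text \<open>The substitution s = t r moves the variable endpoint into the integrand, leaving an
  integral over the fixed interval [0, 1] that depends continuously on its parameters.\<close>

lemma continuous_on_integral_upto:
  fixes f :: "real \<Rightarrow> 'b::metric_space \<Rightarrow> 'a::banach"
  assumes "continuous_on ({0..} \<times> U) (\<lambda>(s, x). f s x)"
  shows "continuous_on ({0..} \<times> U) (\<lambda>(t, x). integral {0..t} (\<lambda>s. f s x))"
proof -
  have scale: "integral {0..t} g = t *\<^sub>R integral {0..1} (\<lambda>r. g (t * r))" if "t \<ge> 0" for t and g :: "real \<Rightarrow> 'a"
  proof (cases "t = 0")
    case False
    with that have "t > 0" by simp
    then show ?thesis using integral_stretch_real[of t 0 t g] by simp
  qed simp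
  have "continuous_on (({0..} \<times> U) \<times> cbox 0 1) (\<lambda>(p, r). f (fst p * r) (snd p))"
    unfolding split_beta
    by (rule continuous_on_compose2[OF assms, of _ "\<lambda>q. (fst (fst q) * snd q, snd (fst q))",
          unfolded split_beta fst_conv snd_conv])
      (auto intro!: continuous_intros)
  from integral_continuous_on_param[OF this]
  have "continuous_on ({0..} \<times> U) (\<lambda>p. fst p *\<^sub>R integral (cbox 0 1) (\<lambda>r. f (fst p * r) (snd p)))"
    by (intro continuous_intros)
  then show ?thesis
    by (rule continuous_on_eq) (auto simp: scale[of _ "\<lambda>s. f s x" for x, symmetric])
qed

lemma has_vector_derivative_integral_upto:
  fixes f :: "real \<Rightarrow> 'a::banach"
  assumes "continuous_on {0..} f" "t \<ge> 0"
  shows "((\<lambda>t. integral {0..t} f) has_vector_derivative f t) (at t within {0..})"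
proof -
  have "((\<lambda>t. integral {0..t} f) has_vector_derivative f t) (at t within {0..t+1})"
    by (rule integral_has_vector_derivative)
      (use assms in \<open>auto intro: continuous_on_subset\<close>)
  moreover have "at t within {0..t+1} = at t within {0..}"
    by (rule at_within_nhd[where S = "{..<t+1}"]) auto
  ultimately show ?thesis by simp
qed

lemma continuous_on_section:
  assumes "continuous_on ({0..} \<times> UNIV) (\<lambda>(t::real, x::'a::topological_space). f t x)" "A \<subseteq> {0..}"
  shows "continuous_on A (\<lambda>s. f s x)"
  by (rule continuous_on_compose2[OF assms(1), of _ "\<lambda>s. (s, x)", simplified])
    (use assms(2) in \<open>auto intro!: continuous_on_Pair continuous_on_id continuous_on_const\<close>)

text \<open>The iterates converge uniformly on bounded time intervals only. Continuity is local, so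
  at time t the slab up to t + 1 decides it.\<close>

lemma continuous_on_slabs:
  fixes f :: "real \<times> 'a::t2_space \<Rightarrow> 'b::topological_space"
  assumes "\<And>T. continuous_on ({0..T} \<times> UNIV) f"
  shows "continuous_on ({0..} \<times> UNIV) f"
proof (clarsimp simp: continuous_on_eq_continuous_within)
  fix t :: real and x :: 'a assume "t \<ge> 0"
  then have "continuous (at (t, x) within {0..t+1} \<times> UNIV) f"
    using assms[of "t+1"] by (simp add: continuous_on_eq_continuous_within)
  moreover have "at (t, x) within {0..t+1} \<times> UNIV = at (t, x) within {0..} \<times> UNIV"
    by (rule at_within_nhd[where S = "{..<t+1} \<times> UNIV"]) (auto intro: open_Times)
  ultimately show "continuous (at (t, x) within {0..} \<times> UNIV) f" by simp
qed

text \<open>One constant serves for all three bounds. Since they are global, every estimate on the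
  iterates is uniform in the starting point.\<close>

locale bounded_lipschitz_field =
  fixes v :: "'a::euclidean_space \<Rightarrow> 'a" and Dv :: "'a \<Rightarrow> 'a \<Rightarrow>\<^sub>L 'a" and L :: real
  assumes L_pos: "L > 0"
    and deriv_v: "\<And>x. (v has_derivative Dv x) (at x)"
    and norm_v: "\<And>x. norm (v x) \<le> L"
    and norm_Dv: "\<And>x. norm (Dv x) \<le> L"
    and lipschitz_Dv: "\<And>x y. norm (Dv x - Dv y) \<le> L * norm (x - y)"
begin

lemma lipschitz_v: "norm (v x - v y) \<le> L * norm (x - y)"
  by (rule differentiable_bound[where S = UNIV and f' = "\<lambda>x. blinfun_apply (Dv x)"])
    (use deriv_v norm_Dv in \<open>auto simp flip: norm_blinfun.rep_eq\<close>)

lemma continuous_on_v: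
  "continuous_on A g \<Longrightarrow> continuous_on A (\<lambda>z. v (g z))"
  by (rule continuous_on_compose2[where t = UNIV])
    (auto intro!: continuous_at_imp_continuous_on has_derivative_continuous deriv_v)

lemma continuous_on_Dv:
  assumes "continuous_on A g"
  shows "continuous_on A (\<lambda>z. Dv (g z))"
proof -
  have "L-lipschitz_on UNIV Dv"
    by (rule lipschitz_onI) (use L_pos lipschitz_Dv in \<open>auto simp: dist_norm\<close>)
  then show ?thesis
    using assms by (auto intro: continuous_on_compose2[OF lipschitz_on_continuous_on])
qed

section \<open>Picard iterates, their spatial derivatives, and geometric estimates\<close>

primrec picard :: "nat \<Rightarrow> real \<Rightarrow> 'a \<Rightarrow> 'a" where
  "picard 0 t x = x"
| "picard (Suc n) t x = x + integral {0..t} (\<lambda>s. v (picard n s x))"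

text \<open>Iteration for the variational equation, linearised along \<open>picard n\<close> rather
  than along the limit, so that step n is exactly the spatial derivative of
  \<open>picard n\<close>.\<close>

primrec picard_deriv :: "nat \<Rightarrow> real \<Rightarrow> 'a \<Rightarrow> 'a \<Rightarrow>\<^sub>L 'a" where
  "picard_deriv 0 t x = id_blinfun"
| "picard_deriv (Suc n) t x =
     id_blinfun + integral {0..t} (\<lambda>s. Dv (picard n s x) o\<^sub>L picard_deriv n s x)"

definition flow :: "real \<Rightarrow> 'a \<Rightarrow> 'a" where
  "flow t x = lim (\<lambda>n. picard n t x)"

definition flow_deriv :: "real \<Rightarrow> 'a \<Rightarrow> 'a \<Rightarrow>\<^sub>L 'a" where
  "flow_deriv t x = lim (\<lambda>n. picard_deriv n t x)"

lemma continuous_on_picard: "continuous_on ({0..} \<times> UNIV) (\<lambda>(t, x). picard n t x)"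
proof (induction n)
  case (Suc n)
  then have "continuous_on ({0..} \<times> UNIV) (\<lambda>(t, x). v (picard n t x))"
    unfolding split_beta by (rule continuous_on_v)
  from continuous_on_add[OF _ continuous_on_integral_upto[OF this]] show ?case
    by (simp add: split_beta continuous_on_snd continuous_on_const)
qed (simp_all add: split_beta continuous_on_snd)

lemma continuous_on_picard_deriv: "continuous_on ({0..} \<times> UNIV) (\<lambda>(t, x). picard_deriv n t x)"
proof (induction n)
  case (Suc n)
  then have "continuous_on ({0..} \<times> UNIV) (\<lambda>(t, x). Dv (picard n t x) o\<^sub>L picard_deriv n t x)"
    using continuous_on_picard[of n] unfolding split_beta
    by (intro bounded_bilinear.continuous_on[OF bounded_bilinear_blinfun_compose] continuous_on_Dv)
  from continuous_on_add[OF _ continuous_on_integral_upto[OF this]] show ?case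
    by (simp add: split_beta continuous_on_snd continuous_on_const)
qed (simp_all add: split_beta continuous_on_snd)

lemmas picard_continuity =
  continuous_on_section[OF continuous_on_picard] continuous_on_section[OF continuous_on_picard_deriv]
  continuous_on_v continuous_on_Dv bounded_bilinear.continuous_on[OF bounded_bilinear_blinfun_compose]
  continuous_on_diff continuous_on_const

text \<open>Each iteration costs the Lipschitz constant L, and integrating the weight of rate 2L
  returns 1/(2L): the ratio is 1/2. Boundedness of the field starts the induction.\<close>

lemma norm_picard_diff:
  assumes "t \<ge> 0"
  shows "norm (picard (Suc n) t x - picard n t x) \<le> (1/2) ^ n * exp (2 * L * t)"
  using assms
proof (induction n arbitrary: t)
  case 0
  have "norm (integral {0..t} (\<lambda>s. v x)) \<le> 1 * (exp (2 * L * t) - 1)"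
  proof (rule norm_integral_le_exp)
    fix s :: real assume s: "0 \<le> s"
    have "L \<le> 1 * (2 * L) * 1" using L_pos by simp
    also have "\<dots> \<le> 1 * (2 * L) * exp (2 * L * s)"
      using L_pos s by (intro mult_left_mono) auto
    finally show "norm (v x) \<le> 1 * (2 * L) * exp (2 * L * s)"
      using norm_v[of x] by linarith
  qed (use 0 L_pos in \<open>auto intro!: picard_continuity\<close>)
  then show ?case by simp
next
  case (Suc n)
  have "norm (integral {0..t} (\<lambda>s. v (picard (Suc n) s x) - v (picard n s x)))
     \<le> (1/2) ^ Suc n * (exp (2 * L * t) - 1)"
  proof (rule norm_integral_le_exp)
    fix s :: real assume s: "0 \<le> s"
    have "norm (v (picard (Suc n) s x) - v (picard n s x)) \<le> L * ((1/2) ^ n * exp (2 * L * s))"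
      using L_pos Suc.IH[OF s] by (intro order.trans[OF lipschitz_v] mult_left_mono) auto
    then show "norm (v (picard (Suc n) s x) - v (picard n s x)) \<le> (1/2) ^ Suc n * (2 * L) * exp (2 * L * s)"
      by (simp add: field_simps)
  qed (use Suc L_pos in \<open>auto intro!: picard_continuity simp del: picard.simps\<close>)
  also have "\<dots> \<le> (1/2) ^ Suc n * exp (2 * L * t)"
    by (simp add: algebra_simps)
  also have "integral {0..t} (\<lambda>s. v (picard (Suc n) s x) - v (picard n s x)) =
      picard (Suc (Suc n)) t x - picard (Suc n) t x"
    unfolding picard.simps(2)[of "Suc n"] picard.simps(2)[of n t]
    by (subst integral_diff)
      (auto intro!: integrable_continuous_real picard_continuity simp del: picard.simps)
  finally show ?case .
qed

text \<open>A Gronwall bound uniform in n: the identity contributes at most 1 and the integral at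
  most exp (L t) - 1.\<close>

lemma norm_picard_deriv:
  assumes "t \<ge> 0"
  shows "norm (picard_deriv n t x) \<le> exp (L * t)"
  using assms
proof (induction n arbitrary: t)
  case 0
  have "norm (picard_deriv 0 t x) \<le> 1"
    unfolding picard_deriv.simps by (rule norm_blinfun_id_le)
  also have "\<dots> \<le> exp (L * t)" using 0 L_pos by simp
  finally show ?case .
next
  case (Suc n)
  have "norm (integral {0..t} (\<lambda>s. Dv (picard n s x) o\<^sub>L picard_deriv n s x)) \<le> 1 * (exp (L * t) - 1)"
  proof (rule norm_integral_le_exp)
    fix s :: real assume s: "0 \<le> s"
    have "norm (Dv (picard n s x) o\<^sub>L picard_deriv n s x) \<le> L * exp (L * s)"
      using L_pos Suc.IH[OF s] by (intro order.trans[OF norm_blinfun_compose] mult_mono norm_Dv) auto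
    then show "norm (Dv (picard n s x) o\<^sub>L picard_deriv n s x) \<le> 1 * L * exp (L * s)" by simp
  qed (use Suc L_pos in \<open>auto intro!: picard_continuity\<close>)
  then show ?case
    using norm_triangle_ineq[of "id_blinfun :: 'a \<Rightarrow>\<^sub>L 'a" "integral {0..t} (\<lambda>s. Dv (picard n s x) o\<^sub>L picard_deriv n s x)"]
      norm_blinfun_id_le[where 'a = 'a] by simp
qed

text \<open>The error has two sources, the moved base point and the previous derivative error. Each
  is at most L (1/2)^n exp (4 L s), so rate 4L is what makes their sum shrink by 1/2.\<close>

lemma norm_picard_deriv_diff:
  assumes "t \<ge> 0"
  shows "norm (picard_deriv (Suc n) t x - picard_deriv n t x) \<le> (1/2) ^ n * exp (4 * L * t)"
  using assms
proof (induction n arbitrary: t)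
  case 0
  have id: "Dv x o\<^sub>L id_blinfun = Dv x" by (rule blinfun_eqI) simp
  have "norm (integral {0..t} (\<lambda>s. Dv x o\<^sub>L id_blinfun)) \<le> 1 * (exp (4 * L * t) - 1)"
  proof (rule norm_integral_le_exp)
    fix s :: real assume s: "0 \<le> s"
    have "L \<le> 1 * (4 * L) * 1" using L_pos by simp
    also have "\<dots> \<le> 1 * (4 * L) * exp (4 * L * s)"
      using L_pos s by (intro mult_left_mono) auto
    finally show "norm (Dv x o\<^sub>L id_blinfun) \<le> 1 * (4 * L) * exp (4 * L * s)"
      using norm_Dv[of x] by (simp add: id)
  qed (use 0 L_pos in \<open>auto intro!: picard_continuity\<close>)
  then show ?case by simp
next
  case (Suc n)
  let ?F = "\<lambda>n s. Dv (picard n s x) o\<^sub>L picard_deriv n s x"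
  have "norm (integral {0..t} (\<lambda>s. ?F (Suc n) s - ?F n s)) \<le> (1/2) ^ Suc n * (exp (4 * L * t) - 1)"
  proof (rule norm_integral_le_exp)
    fix s :: real assume s: "0 \<le> s"
    \<comment> \<open>Product rule for differences. In the first term the rate 2L of
      \<open>norm_picard_diff\<close> and the rate L of \<open>norm_picard_deriv\<close> add up to
      3L, which stays below 4L.\<close>
    have "(?F (Suc n) s) - (?F n s) =
        ((Dv (picard (Suc n) s x) - Dv (picard n s x)) o\<^sub>L picard_deriv n s x)
        + (Dv (picard (Suc n) s x) o\<^sub>L (picard_deriv (Suc n) s x - picard_deriv n s x))"
      by (rule blinfun_eqI) (simp add: blinfun.bilinear_simps del: picard.simps picard_deriv.simps)
    also have "norm \<dots> \<le> (L * ((1/2) ^ n * exp (2 * L * s))) * exp (L * s) + L * ((1/2) ^ n * exp (4 * L * s))"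
      using L_pos norm_picard_diff[OF s, of n x] Suc.IH[OF s] norm_picard_deriv[OF s, of n x]
      by (intro norm_triangle_mono order.trans[OF norm_blinfun_compose] mult_mono norm_Dv
          order.trans[OF lipschitz_Dv]) (auto simp del: picard.simps picard_deriv.simps)
    also have "(L * ((1/2) ^ n * exp (2 * L * s))) * exp (L * s) = L * (1/2)^n * exp (3 * L * s)"
      by (simp add: algebra_simps flip: exp_add)
    also have "\<dots> \<le> L * (1/2)^n * exp (4 * L * s)"
      using L_pos s by (intro mult_left_mono) auto
    finally show "norm (?F (Suc n) s - ?F n s) \<le> (1/2) ^ Suc n * (4 * L) * exp (4 * L * s)"
      by (simp add: field_simps)
  qed (use Suc L_pos in \<open>auto intro!: picard_continuity simp del: picard.simps picard_deriv.simps\<close>)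
  also have "\<dots> \<le> (1/2) ^ Suc n * exp (4 * L * t)"
    by (simp add: algebra_simps)
  also have "integral {0..t} (\<lambda>s. ?F (Suc n) s - ?F n s) =
      picard_deriv (Suc (Suc n)) t x - picard_deriv (Suc n) t x"
    unfolding picard_deriv.simps(2)[of "Suc n"] picard_deriv.simps(2)[of n t]
    by (subst integral_diff)
      (auto intro!: integrable_continuous_real picard_continuity simp del: picard.simps picard_deriv.simps)
  finally show ?case .
qed

text \<open>Differentiation under the integral sign, with the chain rule for the integrand.\<close>

lemma has_derivative_picard:
  assumes "t \<ge> 0"
  shows "(picard n t has_derivative picard_deriv n t x) (at x)"
  using assms
proof (induction n arbitrary: t x)
  case 0
  then show ?case by (auto intro!: derivative_eq_intros simp: id_def)
next
  case (Suc n)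
  have "((\<lambda>x. integral (cbox 0 t) (\<lambda>s. v (picard n s x))) has_derivative
      integral (cbox 0 t) (\<lambda>s. Dv (picard n s x) o\<^sub>L picard_deriv n s x)) (at x within UNIV)"
  proof (rule leibniz_rule)
    fix x s assume "s \<in> cbox 0 t"
    then have "s \<ge> 0" by simp
    from has_derivative_compose[OF Suc.IH[OF this] deriv_v]
    show "((\<lambda>x. v (picard n s x)) has_derivative blinfun_apply (Dv (picard n s x) o\<^sub>L picard_deriv n s x)) (at x within UNIV)"
      by (simp add: blinfun_compose.rep_eq o_def)
  next
    have c: "continuous_on ({0..} \<times> UNIV) (\<lambda>p. Dv (picard n (fst p) (snd p)) o\<^sub>L picard_deriv n (fst p) (snd p))"
      using continuous_on_picard[of n] continuous_on_picard_deriv[of n] unfolding split_beta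
      by (intro bounded_bilinear.continuous_on[OF bounded_bilinear_blinfun_compose] continuous_on_Dv)
    show "continuous_on (UNIV \<times> cbox 0 t) (\<lambda>(x, s). Dv (picard n s x) o\<^sub>L picard_deriv n s x)"
      unfolding split_beta
      by (rule continuous_on_compose2[OF c, of _ "\<lambda>p. (snd p, fst p)", unfolded fst_conv snd_conv])
        (auto intro!: continuous_intros)
  qed (auto intro!: integrable_continuous_real picard_continuity)
  then show ?case
    by (auto intro!: derivative_eq_intros simp: blinfun.bilinear_simps)
qed

section \<open>Passage to the limit\<close>

lemma uniform_limit_picard:
  "uniform_limit ({0..T} \<times> UNIV) (\<lambda>n (t, x). picard n t x) (\<lambda>(t, x). flow t x) sequentially"
proof -
  have "norm (picard (Suc n) t x - picard n t x) \<le> exp (2 * L * T) * (1/2) ^ n" if "0 \<le> t" "t \<le> T" for n t x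
  proof -
    have "(1/2) ^ n * exp (2 * L * t) \<le> (1/2) ^ n * exp (2 * L * T)"
      using that L_pos by (intro mult_left_mono) auto
    then show ?thesis using norm_picard_diff[OF that(1), of n x] by (subst mult.commute) linarith
  qed
  then show ?thesis
    unfolding flow_def split_beta
    by (intro uniform_limit_geometric) (auto simp del: picard.simps)
qed

lemma uniform_limit_picard_deriv:
  "uniform_limit ({0..T} \<times> UNIV) (\<lambda>n (t, x). picard_deriv n t x) (\<lambda>(t, x). flow_deriv t x) sequentially"
proof -
  have "norm (picard_deriv (Suc n) t x - picard_deriv n t x) \<le> exp (4 * L * T) * (1/2) ^ n" if "0 \<le> t" "t \<le> T" for n t x
  proof -
    have "(1/2) ^ n * exp (4 * L * t) \<le> (1/2) ^ n * exp (4 * L * T)"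
      using that L_pos by (intro mult_left_mono) auto
    then show ?thesis using norm_picard_deriv_diff[OF that(1), of n x] by (subst mult.commute) linarith
  qed
  then show ?thesis
    unfolding flow_deriv_def split_beta
    by (intro uniform_limit_geometric) (auto simp del: picard_deriv.simps)
qed

lemma picard_tendsto: "t \<ge> 0 \<Longrightarrow> (\<lambda>n. picard n t x) \<longlonglongrightarrow> flow t x"
  using tendsto_uniform_limitI[OF uniform_limit_picard[of t], of "(t, x)"] by simp

lemma picard_deriv_tendsto: "t \<ge> 0 \<Longrightarrow> (\<lambda>n. picard_deriv n t x) \<longlonglongrightarrow> flow_deriv t x"
  using tendsto_uniform_limitI[OF uniform_limit_picard_deriv[of t], of "(t, x)"] by simp

lemma continuous_on_flow: "continuous_on ({0..} \<times> UNIV) (\<lambda>(t, x). flow t x)"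
proof (rule continuous_on_slabs)
  fix T show "continuous_on ({0..T} \<times> UNIV) (\<lambda>(t, x). flow t x)"
    by (rule uniform_limit_theorem[OF _ uniform_limit_picard])
      (auto intro!: always_eventually continuous_on_subset[OF continuous_on_picard])
qed

lemma continuous_on_flow_deriv: "continuous_on ({0..} \<times> UNIV) (\<lambda>(t, x). flow_deriv t x)"
proof (rule continuous_on_slabs)
  fix T show "continuous_on ({0..T} \<times> UNIV) (\<lambda>(t, x). flow_deriv t x)"
    by (rule uniform_limit_theorem[OF _ uniform_limit_picard_deriv])
      (auto intro!: always_eventually continuous_on_subset[OF continuous_on_picard_deriv])
qed

lemmas continuous_flow_time =
  continuous_on_section[OF continuous_on_flow] continuous_on_section[OF continuous_on_flow_deriv]

text \<open>The derivatives converge uniformly in x and the iterates converge at one point, here 0,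
  so the limit may be differentiated termwise.\<close>

lemma has_derivative_flow:
  assumes "t \<ge> 0"
  shows "(flow t has_derivative flow_deriv t x) (at x)"
proof -
  have "\<exists>g. \<forall>x\<in>UNIV. (\<lambda>n. picard n t x) \<longlonglongrightarrow> g x \<and> (g has_derivative flow_deriv t x) (at x within UNIV)"
  proof (rule has_derivative_sequence)
    fix e :: real assume "e > 0"
    from uniform_limitD[OF uniform_limit_picard_deriv[of t] this]
    have "\<forall>\<^sub>F n in sequentially. \<forall>x. norm (picard_deriv n t x - flow_deriv t x) < e"
      by (rule eventually_mono) (use assms in \<open>auto simp: dist_norm\<close>)
    then show "\<forall>\<^sub>F n in sequentially. \<forall>x\<in>UNIV. \<forall>h::'a. norm (picard_deriv n t x h - flow_deriv t x h) \<le> e * norm h"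
    proof (rule eventually_mono, safe)
      fix n and x h :: 'a assume "\<forall>x. norm (picard_deriv n t x - flow_deriv t x) < e"
      then have "norm (picard_deriv n t x - flow_deriv t x) * norm h \<le> e * norm h"
        by (intro mult_right_mono) (auto intro: less_imp_le)
      then show "norm (picard_deriv n t x h - flow_deriv t x h) \<le> e * norm h"
        using norm_blinfun[of "picard_deriv n t x - flow_deriv t x" h] by (simp add: blinfun.diff_left)
    qed
  qed (use assms in \<open>auto intro: has_derivative_picard picard_tendsto[of t 0]\<close>)
  then obtain g where g: "\<And>x. (\<lambda>n. picard n t x) \<longlonglongrightarrow> g x" "\<And>x. (g has_derivative flow_deriv t x) (at x)"
    by auto
  have "g = flow t"
    using LIMSEQ_unique[OF g(1) picard_tendsto[OF assms]] by blast
  with g(2) show ?thesis by simp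
qed

text \<open>The Lipschitz bound carries uniform convergence from the iterates to the integrands, so
  the limit passes through the integral.\<close>

lemma flow_integral:
  assumes "t \<ge> 0"
  shows "flow t x = x + integral {0..t} (\<lambda>s. v (flow s x))"
proof -
  have "uniform_limit {0..t} (\<lambda>n s. v (picard n s x)) (\<lambda>s. v (flow s x)) sequentially"
  proof (rule uniform_limitI)
    fix e :: real assume "e > 0"
    then have "e / L > 0" using L_pos by simp
    from uniform_limitD[OF uniform_limit_picard[of t] this]
    show "\<forall>\<^sub>F n in sequentially. \<forall>s\<in>{0..t}. dist (v (picard n s x)) (v (flow s x)) < e"
    proof (rule eventually_mono, safe)
      fix n s assume *: "\<forall>z\<in>{0..t} \<times> UNIV. dist (case z of (t, x) \<Rightarrow> picard n t x) (case z of (t, x) \<Rightarrow> flow t x) < e / L"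
        and "s \<in> {0..t}"
      then have "norm (picard n s x - flow s x) < e / L" by (auto simp: dist_norm)
      then show "dist (v (picard n s x)) (v (flow s x)) < e"
        using lipschitz_v[of "picard n s x" "flow s x"] L_pos by (simp add: dist_norm field_simps)
    qed
  qed
  then obtain I J where *: "\<And>n. ((\<lambda>s. v (picard n s x)) has_integral I n) {0..t}"
    "((\<lambda>s. v (flow s x)) has_integral J) {0..t}" "I \<longlonglongrightarrow> J"
    by (rule uniform_limit_integral) (auto intro!: picard_continuity)
  have "(\<lambda>n. x + I n) \<longlonglongrightarrow> x + J" by (intro tendsto_intros *)
  moreover have "x + I n = picard (Suc n) t x" for n
    using *(1)[of n] by (simp add: integral_unique)
  ultimately have "(\<lambda>n. picard (Suc n) t x) \<longlonglongrightarrow> x + J" by simp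
  with LIMSEQ_Suc[OF picard_tendsto[OF assms]] have "flow t x = x + J"
    by (blast intro: LIMSEQ_unique)
  with *(2) show ?thesis by (simp add: integral_unique)
qed

text \<open>As for \<open>flow_integral\<close>, except that the integrand is a product. Uniform
  convergence of a product needs both limits bounded: \<open>Dv\<close> is bounded by L, and
  \<open>flow_deriv\<close> inherits the Gronwall bound of the iterates.\<close>

lemma flow_deriv_integral:
  assumes "t \<ge> 0"
  shows "flow_deriv t x = id_blinfun + integral {0..t} (\<lambda>s. Dv (flow s x) o\<^sub>L flow_deriv s x)"
proof -
  have bound: "norm (flow_deriv s x) \<le> exp (L * t)" if "s \<in> {0..t}" for s
  proof -
    have "norm (flow_deriv s x) \<le> exp (L * s)"
      by (rule LIMSEQ_le_const2[OF tendsto_norm[OF picard_deriv_tendsto]])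
        (use that norm_picard_deriv in auto)
    also have "\<dots> \<le> exp (L * t)" using that L_pos by simp
    finally show ?thesis .
  qed
  have "uniform_limit {0..t} (\<lambda>n s. picard n s x) (\<lambda>s. flow s x) sequentially"
    using uniform_limit_compose'[OF uniform_limit_picard[of t], of "\<lambda>s. (s, x)" "{0..t}"] by auto
  then have "uniform_limit {0..t} (\<lambda>n s. Dv (picard n s x)) (\<lambda>s. Dv (flow s x)) sequentially"
    unfolding uniform_limit_iff
  proof safe
    fix e :: real assume *: "\<forall>e>0. \<forall>\<^sub>F n in sequentially. \<forall>s\<in>{0..t}. dist (picard n s x) (flow s x) < e" and "e > 0"
    then have "e / L > 0" using L_pos by simp
    with * have "\<forall>\<^sub>F n in sequentially. \<forall>s\<in>{0..t}. dist (picard n s x) (flow s x) < e / L" by blast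
    then show "\<forall>\<^sub>F n in sequentially. \<forall>s\<in>{0..t}. dist (Dv (picard n s x)) (Dv (flow s x)) < e"
    proof (rule eventually_mono, safe)
      fix n s assume *: "\<forall>s\<in>{0..t}. dist (picard n s x) (flow s x) < e / L" and "s \<in> {0..t}"
      then have "norm (picard n s x - flow s x) < e / L" by (auto simp: dist_norm)
      then show "dist (Dv (picard n s x)) (Dv (flow s x)) < e"
        using lipschitz_Dv[of "picard n s x" "flow s x"] L_pos by (simp add: dist_norm field_simps)
    qed
  qed
  moreover have "uniform_limit {0..t} (\<lambda>n s. picard_deriv n s x) (\<lambda>s. flow_deriv s x) sequentially"
    using uniform_limit_compose'[OF uniform_limit_picard_deriv[of t], of "\<lambda>s. (s, x)" "{0..t}"] by auto
  ultimately have "uniform_limit {0..t} (\<lambda>n s. Dv (picard n s x) o\<^sub>L picard_deriv n s x)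
      (\<lambda>s. Dv (flow s x) o\<^sub>L flow_deriv s x) sequentially"
    by (rule bounded_bilinear.bounded_uniform_limit[OF bounded_bilinear_blinfun_compose])
      (auto simp: bounded_iff intro!: norm_Dv bound)
  then obtain I J where *: "\<And>n. ((\<lambda>s. Dv (picard n s x) o\<^sub>L picard_deriv n s x) has_integral I n) {0..t}"
    "((\<lambda>s. Dv (flow s x) o\<^sub>L flow_deriv s x) has_integral J) {0..t}" "I \<longlonglongrightarrow> J"
    by (rule uniform_limit_integral) (auto intro!: picard_continuity)
  have "(\<lambda>n. id_blinfun + I n) \<longlonglongrightarrow> id_blinfun + J" by (intro tendsto_intros *)
  moreover have "id_blinfun + I n = picard_deriv (Suc n) t x" for n
    using *(1)[of n] by (simp add: integral_unique)
  ultimately have "(\<lambda>n. picard_deriv (Suc n) t x) \<longlonglongrightarrow> id_blinfun + J" by simp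
  with LIMSEQ_Suc[OF picard_deriv_tendsto[OF assms]] have "flow_deriv t x = id_blinfun + J"
    by (blast intro: LIMSEQ_unique)
  with *(2) show ?thesis by (simp add: integral_unique)
qed

lemma flow_ode:
  assumes "t \<ge> 0"
  shows "((\<lambda>t. flow t x) has_vector_derivative v (flow t x)) (at t within {0..})"
proof -
  have "((\<lambda>t. x + integral {0..t} (\<lambda>s. v (flow s x))) has_vector_derivative v (flow t x)) (at t within {0..})"
    by (auto intro!: derivative_eq_intros has_vector_derivative_integral_upto picard_continuity continuous_flow_time assms)
  then show ?thesis
    by (rule has_vector_derivative_transform[rotated 2]) (use assms flow_integral in auto)
qed

lemma flow_deriv_ode:
  assumes "t \<ge> 0"
  shows "((\<lambda>t. flow_deriv t x h) has_vector_derivative Dv (flow t x) (flow_deriv t x h)) (at t within {0..})"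
proof -
  have "((\<lambda>t. id_blinfun + integral {0..t} (\<lambda>s. Dv (flow s x) o\<^sub>L flow_deriv s x))
      has_vector_derivative Dv (flow t x) o\<^sub>L flow_deriv t x) (at t within {0..})"
    by (auto intro!: derivative_eq_intros has_vector_derivative_integral_upto picard_continuity continuous_flow_time assms)
  then have "((\<lambda>t. flow_deriv t x) has_vector_derivative Dv (flow t x) o\<^sub>L flow_deriv t x) (at t within {0..})"
    by (rule has_vector_derivative_transform[rotated 2]) (use assms flow_deriv_integral in auto)
  from bounded_linear.has_vector_derivative[OF blinfun.bounded_linear_left this]
  show ?thesis by simp
qed

section \<open>Initial values, translations, fixed points and transport of the field\<close>

lemma flow_0 [simp]: "flow 0 x = x"
  using flow_integral[of 0 x] by simp

lemma flow_deriv_0 [simp]: "flow_deriv 0 x = id_blinfun"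
  using flow_deriv_integral[of 0 x] by simp

text \<open>Every Picard iterate commutes with a translation that preserves the field. It serves
  both for the periods of the torus and for arbitrary shifts in the third direction.\<close>

lemma flow_add_period:
  assumes "\<And>x. v (x + c) = v x" "t \<ge> 0"
  shows "flow t (x + c) = flow t x + c"
proof -
  have "picard n t (x + c) = picard n t x + c" for n t x
    by (induction n arbitrary: t) (simp_all add: assms)
  then have "(\<lambda>n. picard n t x + c) \<longlonglongrightarrow> flow t (x + c)"
    using picard_tendsto[OF assms(2), of "x + c"] by simp
  moreover have "(\<lambda>n. picard n t x + c) \<longlonglongrightarrow> flow t x + c"
    by (intro tendsto_intros picard_tendsto assms)
  ultimately show ?thesis by (rule LIMSEQ_unique)
qed

lemma flow_fixpoint:
  assumes "v x = 0" "t \<ge> 0"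
  shows "flow t x = x"
proof -
  have "picard n t x = x" for n t
    by (induction n arbitrary: t) (simp_all add: assms)
  then show ?thesis
    using picard_tendsto[OF assms(2), of x] by (simp add: LIMSEQ_const_iff)
qed

text \<open>Both sides solve the variational equation along the trajectory of \<open>x\<close>, with the same initial value.\<close>
lemma flow_deriv_v:
  assumes "t \<ge> 0"
  shows "flow_deriv t x (v x) = v (flow t x)"
proof -
  define Z where "Z s = flow_deriv s x (v x) - v (flow s x)" for s
  have dZ: "(Z has_vector_derivative Dv (flow s x) (Z s)) (at s within {0..})" if "s \<ge> 0" for s
  proof -
    have "((\<lambda>s. v (flow s x)) has_vector_derivative Dv (flow s x) (v (flow s x))) (at s within {0..})"
      using has_derivative_compose[OF flow_ode[OF that, unfolded has_vector_derivative_def] deriv_v]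
      by (simp add: has_vector_derivative_def blinfun.scaleR_right)
    from has_vector_derivative_diff[OF flow_deriv_ode[OF that] this]
    show ?thesis by (simp add: Z_def[abs_def] blinfun.diff_right)
  qed
  \<comment> \<open>The bound L on \<open>Dv\<close> lets the square of the norm of Z grow at rate
    at most 2L, so the weighted square is nonincreasing. It starts at 0, since at time 0 the flow is
    the identity.\<close>
  define g where "g s = exp (- 2 * L * s) * (Z s \<bullet> Z s)" for s
  have dg: "(g has_real_derivative exp (- 2 * L * s) * (2 * (Z s \<bullet> Dv (flow s x) (Z s)) - 2 * L * (Z s \<bullet> Z s)))
      (at s within {0..})" if "s \<ge> 0" for s
  proof -
    have "((\<lambda>s. Z s \<bullet> Z s) has_vector_derivative 2 * (Z s \<bullet> Dv (flow s x) (Z s))) (at s within {0..})"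
      using bounded_bilinear.has_vector_derivative[OF bounded_bilinear_inner dZ[OF that] dZ[OF that]]
      by (simp add: inner_commute)
    then have "((\<lambda>s. Z s \<bullet> Z s) has_real_derivative 2 * (Z s \<bullet> Dv (flow s x) (Z s))) (at s within {0..})"
      by (simp add: has_real_derivative_iff_has_vector_derivative)
    then show ?thesis
      unfolding g_def by (auto intro!: derivative_eq_intros simp: algebra_simps)
  qed
  have neg: "exp (- 2 * L * s) * (2 * (Z s \<bullet> Dv (flow s x) (Z s)) - 2 * L * (Z s \<bullet> Z s)) \<le> 0" for s
  proof -
    have "Z s \<bullet> Dv (flow s x) (Z s) \<le> norm (Z s) * norm (Dv (flow s x) (Z s))"
      by (rule norm_cauchy_schwarz)
    also have "\<dots> \<le> norm (Z s) * (L * norm (Z s))"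
      by (intro mult_left_mono order.trans[OF norm_blinfun] mult_right_mono norm_Dv) auto
    finally show ?thesis
      by (simp add: mult_le_0_iff power2_norm_eq_inner[symmetric] power2_eq_square algebra_simps)
  qed
  have "g t \<le> g 0"
  proof (rule DERIV_nonpos_imp_decreasing_open[OF assms])
    fix s assume s: "0 < s" "s < t"
    then have "at s within {0..} = at s"
      by (intro at_within_interior) (auto simp: interior_real_atLeast)
    with dg[of s] neg[of s] s show "\<exists>y. (g has_real_derivative y) (at s) \<and> y \<le> 0" by auto
  next
    show "continuous_on {0..t} g"
      by (rule continuous_on_subset[of "{0..}"])
        (auto intro!: DERIV_continuous_on[OF dg])
  qed
  also have "g 0 = 0" by (simp add: g_def Z_def)
  finally have "Z t \<bullet> Z t \<le> 0" by (simp add: g_def mult_le_0_iff)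
  then have "Z t = 0"
    using inner_ge_zero[of "Z t"] by (simp add: order_antisym)
  then show ?thesis by (simp add: Z_def)
qed

end

section \<open>Trigonometric polynomials\<close>

text \<open>A triple holds wave vector, phase and vector amplitude. Phases cover cosines as well as
  sines and make the class closed under differentiation.\<close>

definition modes :: "('e \<times> real \<times> 'a) list \<Rightarrow> 'e::real_inner \<Rightarrow> 'a::real_normed_vector" where
  "modes ms x = (\<Sum>(a, c, b)\<leftarrow>ms. sin (a \<bullet> x + c) *\<^sub>R b)"

definition modes_deriv :: "('e \<times> real \<times> 'a) list \<Rightarrow> 'e::real_inner \<Rightarrow> 'e \<Rightarrow>\<^sub>L 'a::real_normed_vector" where
  "modes_deriv ms x =
     (\<Sum>(a, c, b)\<leftarrow>ms. cos (a \<bullet> x + c) *\<^sub>R (blinfun_scaleR_left b o\<^sub>L blinfun_inner_left a))"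

lemma modes_simps [simp]:
  "modes [] x = 0"
  "modes ((a, c, b) # ms) x = sin (a \<bullet> x + c) *\<^sub>R b + modes ms x"
  by (simp_all add: modes_def)

lemma modes_deriv_simps:
  "modes_deriv [] x = 0"
  "modes_deriv ((a, c, b) # ms) x =
     cos (a \<bullet> x + c) *\<^sub>R (blinfun_scaleR_left b o\<^sub>L blinfun_inner_left a) + modes_deriv ms x"
  by (simp_all add: modes_deriv_def)

lemma modes_deriv_apply [simp]:
  "modes_deriv [] x h = 0"
  "modes_deriv ((a, c, b) # ms) x h = (cos (a \<bullet> x + c) * (a \<bullet> h)) *\<^sub>R b + modes_deriv ms x h"
  by (simp_all add: modes_deriv_simps blinfun.bilinear_simps inner_commute)

lemma has_derivative_modes: "(modes ms has_derivative modes_deriv ms x) (at x)"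
proof (induction ms)
  case (Cons m ms)
  obtain a c b where m: "m = (a, c, b)" by (cases m)
  have "((\<lambda>x. sin (a \<bullet> x + c) *\<^sub>R b + modes ms x) has_derivative
      (\<lambda>h. (cos (a \<bullet> x + c) * (a \<bullet> h)) *\<^sub>R b + modes_deriv ms x h)) (at x)"
    by (auto intro!: derivative_eq_intros Cons simp: mult.commute)
  then show ?case by (simp add: m modes_simps[abs_def] modes_deriv_apply[abs_def])
qed (simp add: modes_simps[abs_def] modes_deriv_apply[abs_def])

lemma abs_cos_diff_le: "\<bar>cos x - cos y\<bar> \<le> \<bar>x - y\<bar>" for x y :: real
proof -
  have "norm (cos x - cos y) \<le> 1 * norm (x - y)"
    by (rule field_differentiable_bound[where S = UNIV and f' = "\<lambda>x. - sin x"])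
      (auto intro!: derivative_eq_intros)
  then show ?thesis by simp
qed

text \<open>Sine and cosine are bounded by 1 and cosine is 1-Lipschitz, so each mode adds a finite
  amount to each of the three bounds.\<close>

lemma modes_bounded_lipschitz:
  fixes ms :: "('a::euclidean_space \<times> real \<times> 'a) list"
  shows "\<exists>L. bounded_lipschitz_field (modes ms) (modes_deriv ms) L"
proof -
  have bd: "\<exists>C>0. (\<forall>x. norm (modes ms x) \<le> C) \<and> (\<forall>x. norm (modes_deriv ms x) \<le> C) \<and>
      (\<forall>x y. norm (modes_deriv ms x - modes_deriv ms y) \<le> C * norm (x - y))"
  proof (induction ms)
    case Nil
    then show ?case by (intro exI[of _ 1]) (simp add: modes_deriv_simps)
  next
    case (Cons m ms)
    obtain a c b where m: "m = (a, c, b)" by (cases m)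
    obtain C where C: "C > 0" "\<And>x. norm (modes ms x) \<le> C" "\<And>x. norm (modes_deriv ms x) \<le> C"
      "\<And>x y. norm (modes_deriv ms x - modes_deriv ms y) \<le> C * norm (x - y)"
      using Cons by blast
    define R where "R = blinfun_scaleR_left b o\<^sub>L blinfun_inner_left a"
    have 1: "norm (modes (m # ms) x) \<le> norm b + C" for x
    proof -
      have "\<bar>sin (a \<bullet> x + c)\<bar> * norm b \<le> 1 * norm b" by (intro mult_right_mono) auto
      then show ?thesis unfolding m modes_simps
        by (intro norm_triangle_mono C) simp
    qed
    have 2: "norm (modes_deriv (m # ms) x) \<le> norm R + C" for x
    proof -
      have "\<bar>cos (a \<bullet> x + c)\<bar> * norm R \<le> 1 * norm R" by (intro mult_right_mono) auto
      then show ?thesis unfolding m modes_deriv_simps R_def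
        by (intro norm_triangle_mono C) simp
    qed
    have 3: "norm (modes_deriv (m # ms) x - modes_deriv (m # ms) y) \<le> (norm a * norm R + C) * norm (x - y)" for x y
    proof -
      have "\<bar>cos (a \<bullet> x + c) - cos (a \<bullet> y + c)\<bar> \<le> \<bar>a \<bullet> (x - y)\<bar>"
        using abs_cos_diff_le[of "a \<bullet> x + c" "a \<bullet> y + c"] by (simp add: inner_diff_right)
      also have "\<dots> \<le> norm a * norm (x - y)" by (rule Cauchy_Schwarz_ineq2)
      finally have "norm ((cos (a \<bullet> x + c) - cos (a \<bullet> y + c)) *\<^sub>R R) \<le> norm a * norm (x - y) * norm R"
        by (simp add: mult_right_mono)
      from norm_triangle_mono[OF this C(4)[of x y]] show ?thesis
        by (simp add: m modes_deriv_simps flip: R_def) (simp add: algebra_simps)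
    qed
    define K where "K = norm b + norm R + norm a * norm R + C"
    have "K > 0" "norm b + C \<le> K" "norm R + C \<le> K" "norm a * norm R + C \<le> K"
      using C(1) by (auto simp: K_def intro: add_nonneg_pos)
    then show ?case
      by (intro exI[of _ K] conjI allI order.trans[OF 1] order.trans[OF 2] order.trans[OF 3] mult_right_mono) auto
  qed
  then show ?thesis
    by (auto simp: bounded_lipschitz_field_def has_derivative_modes)
qed

lemma partial_eq: "(f has_derivative D) (at x) \<Longrightarrow> partial i f x = D (axis i 1)"
  by (simp add: partial_def frechet_derivative_at[symmetric])

text \<open>A derivative of a sine is again a sine with phase advanced by pi / 2. Hence smoothness
  in \<open>Ck_modes\<close> follows by induction over all mode lists at once.\<close>

lemma partial_modes:
  "partial i (modes ms) = modes (map (\<lambda>(a, c, b). (a, c + pi / 2, (a $ i) *\<^sub>R b)) ms)"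
proof
  fix x
  have "modes_deriv ms x (axis i 1) = modes (map (\<lambda>(a, c, b). (a, c + pi / 2, (a $ i) *\<^sub>R b)) ms) x"
    by (induction ms) (auto simp: inner_axis sin_add simp flip: add.assoc)
  then show "partial i (modes ms) x = modes (map (\<lambda>(a, c, b). (a, c + pi / 2, (a $ i) *\<^sub>R b)) ms) x"
    by (simp add: partial_eq[OF has_derivative_modes])
qed

lemma continuous_on_modes: "continuous_on A (modes ms)"
  using has_derivative_modes by (blast intro: continuous_at_imp_continuous_on has_derivative_continuous)

lemma Ck_modes: "Ck k (modes ms)"
proof (induction k arbitrary: ms)
  case (Suc k)
  then show ?case
    using has_derivative_modes by (auto simp: differentiable_def partial_modes)
qed (simp add: continuous_on_modes)

section \<open>A lower bound for the essential supremum\<close>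

text \<open>Otherwise the points where f exceeds the essential supremum form an open set around x.
  As x lies in the closure of the open box, this set meets the box in a nonempty open set, which is
  not null. The point x may lie on the boundary.\<close>

lemma le_esssup_cbox:
  fixes f :: "'a::euclidean_space \<Rightarrow> real"
  assumes "continuous_on UNIV f" "x \<in> cbox a b" "box a b \<noteq> {}"
  shows "ereal (f x) \<le> esssup (lebesgue_on (cbox a b)) (\<lambda>y. ereal (f y))"
proof (rule ccontr)
  let ?c = "esssup (lebesgue_on (cbox a b)) (\<lambda>y. ereal (f y))"
  assume "\<not> ?thesis"
  then have x: "?c < ereal (f x)" by simp
  define U where "U = {y. ?c < ereal (f y)}"
  have "open U"
    unfolding U_def by (intro open_Collect_less continuous_intros assms(1))
  have "x \<in> closure (box a b)"
    using assms by simp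
  then obtain z where z: "z \<in> box a b" "z \<in> U"
    using \<open>open U\<close> x unfolding closure_iff_nhds_not_empty U_def by blast
  have "AE y in lebesgue_on (cbox a b). ereal (f y) \<le> ?c"
    by (rule esssup_AE)
  then have "AE y in lebesgue. y \<in> cbox a b \<longrightarrow> ereal (f y) \<le> ?c"
    by (subst (asm) AE_restrict_space_iff) auto
  then have "AE y in lebesgue. y \<notin> U \<inter> box a b"
    by (rule AE_mp) (use box_subset_cbox[of a b] in \<open>auto simp: U_def not_less\<close>)
  moreover have "open (U \<inter> box a b)" using \<open>open U\<close> by auto
  ultimately have "negligible (U \<inter> box a b)"
    by (auto simp: negligible_iff_null_sets AE_iff_null_sets)
  with \<open>open (U \<inter> box a b)\<close> z show False
    using open_not_negligible by blast
qed

section \<open>The cellular flow and the transported component\<close>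

text \<open>The product-to-sum formulas for sin x1 cos x2 and - cos x1 sin x2, in the wave vectors
  (1, 1, 0) and (1, -1, 0).\<close>

abbreviation cell_modes :: "((real ^ 3) \<times> real \<times> (real ^ 3)) list" where
  "cell_modes \<equiv> [(vector [1, 1, 0], 0, vector [1/2, -1/2, 0]), (vector [1, -1, 0], 0, vector [1/2, 1/2, 0])]"

definition cell :: "real ^ 3 \<Rightarrow> real ^ 3" where "cell = modes cell_modes"

definition cell_deriv :: "real ^ 3 \<Rightarrow> (real ^ 3) \<Rightarrow>\<^sub>L (real ^ 3)" where "cell_deriv = modes_deriv cell_modes"

lemma inner_vector_3: "vector [a, b, c] \<bullet> (x :: real ^ 3) = a * x $ 1 + b * x $ 2 + c * x $ 3"
  by (simp add: inner_vec_def sum_3 vector_3)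

lemma cell_nth:
  "cell x $ 1 = sin (x $ 1) * cos (x $ 2)"
  "cell x $ 2 = - cos (x $ 1) * sin (x $ 2)"
  "cell x $ 3 = 0"
  by (simp_all add: cell_def inner_vector_3 vector_3 sin_add sin_diff) (simp_all add: field_simps)

lemma cell_deriv_nth:
  "cell_deriv x h $ 1 = cos (x $ 1) * cos (x $ 2) * h $ 1 - sin (x $ 1) * sin (x $ 2) * h $ 2"
  "cell_deriv x h $ 2 = sin (x $ 1) * sin (x $ 2) * h $ 1 - cos (x $ 1) * cos (x $ 2) * h $ 2"
  "cell_deriv x h $ 3 = 0"
  by (simp_all add: cell_deriv_def inner_vector_3 vector_3 cos_add cos_diff algebra_simps add_divide_distrib diff_divide_distrib)

lemma axis_nth: "axis i a $ j = (if j = i then a else 0)"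
  by (simp add: axis_def)

lemma cell_0: "cell 0 = 0"
  by (simp add: vec_eq_iff forall_3 cell_nth)

lemma cell_periodic: "cell (x + (2 * pi) *\<^sub>R axis i 1) = cell x"
  using exhaust_3[of i] by (auto simp: vec_eq_iff forall_3 cell_nth axis_nth)

lemma cell_translate_3: "cell (x + s *\<^sub>R axis 3 1) = cell x"
  by (simp add: vec_eq_iff forall_3 cell_nth axis_nth)

text \<open>Later facts about the flow do not mention the constant, so its existence suffices and a
  choice operator supplies it.\<close>

interpretation cell: bounded_lipschitz_field cell cell_deriv "SOME L. bounded_lipschitz_field cell cell_deriv L"
  unfolding cell_def cell_deriv_def by (rule someI_ex[OF modes_bounded_lipschitz])

abbreviation "back_flow \<equiv> cell.flow"
abbreviation "back_flow_deriv \<equiv> cell.flow_deriv"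

text \<open>The planar velocity is \<open>- cell\<close>, so following \<open>cell\<close> for time
  t leads back to where a particle started. The third component is the initial value sin x1 read off
  there.\<close>

definition vel :: "real \<Rightarrow> real ^ 3 \<Rightarrow> real ^ 3" where
  "vel t x = - cell x + sin (back_flow t x $ 1) *\<^sub>R axis 3 1"

text \<open>The field does not depend on x3, so the flow commutes with all vertical shifts;
  differentiating in the shift gives the claim.\<close>

lemma back_flow_deriv_axis_3:
  assumes "t \<ge> 0"
  shows "back_flow_deriv t x (axis 3 1) = axis 3 1"
proof -
  let ?g = "\<lambda>s. back_flow t (x + s *\<^sub>R axis 3 1)"
  have "((\<lambda>s. x + s *\<^sub>R axis 3 1) has_derivative (\<lambda>s. s *\<^sub>R axis 3 1)) (at (0::real))"
    by (auto intro!: derivative_eq_intros)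
  moreover have "(back_flow t has_derivative back_flow_deriv t x) (at (x + 0 *\<^sub>R axis 3 1))"
    using cell.has_derivative_flow[OF assms, of x] by simp
  ultimately have "(?g has_derivative (\<lambda>s. back_flow_deriv t x (s *\<^sub>R axis 3 1))) (at 0)"
    by (rule has_derivative_compose)
  moreover have "?g = (\<lambda>s. back_flow t x + s *\<^sub>R axis 3 1)"
    using cell.flow_add_period[OF cell_translate_3 assms] by blast
  moreover have "((\<lambda>s. back_flow t x + s *\<^sub>R axis 3 1) has_derivative (\<lambda>s. s *\<^sub>R axis 3 1)) (at (0::real))"
    by (auto intro!: derivative_eq_intros)
  ultimately have "(\<lambda>s. back_flow_deriv t x (s *\<^sub>R axis 3 1)) = (\<lambda>s. s *\<^sub>R axis 3 1)"
    by (metis has_derivative_unique)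
  from fun_cong[OF this, of 1] show ?thesis by simp
qed

text \<open>The origin is a fixed point where \<open>cell_deriv\<close> is diag (1, -1, 0). The
  variational equation for the first component reduces to m' = m with m(0) = 1.\<close>

lemma back_flow_deriv_origin:
  assumes "t \<ge> 0"
  shows "back_flow_deriv t 0 (axis 1 1) $ 1 = exp t"
proof -
  define m where "m s = back_flow_deriv s 0 (axis 1 1) $ 1" for s
  have dm: "(m has_real_derivative m s) (at s within {0..})" if "s \<ge> 0" for s
  proof -
    have "((\<lambda>s. back_flow_deriv s 0 (axis 1 1)) has_vector_derivative
        cell_deriv 0 (back_flow_deriv s 0 (axis 1 1))) (at s within {0..})"
      using cell.flow_deriv_ode[OF that, of 0 "axis 1 1"] cell.flow_fixpoint[OF cell_0 that]
      by simp
    from bounded_linear.has_vector_derivative[OF bounded_linear_vec_nth[of 1] this]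
    show ?thesis
      by (simp add: has_real_derivative_iff_has_vector_derivative m_def[abs_def] cell_deriv_nth)
  qed
  \<comment> \<open>Integrating factor: the product has zero derivative on the half-line and is
    therefore constant.\<close>
  have "((\<lambda>s. m s * exp (- s)) has_real_derivative 0) (at s within {0..})" if "s \<ge> 0" for s
    by (auto intro!: derivative_eq_intros dm that)
  then obtain c where c: "\<And>s. s \<ge> 0 \<Longrightarrow> m s * exp (- s) = c"
    using has_field_derivative_zero_constant[of "{0::real..}" "\<lambda>s. m s * exp (- s)"] by auto
  have "m t * exp (- t) = m 0 * exp (- 0)"
    using c[OF assms] c[of 0] by simp
  then show ?thesis
    by (simp add: m_def exp_minus field_simps axis_nth blinfun.bilinear_simps)
qed

section \<open>Space and time derivatives of the velocity\<close>

lemma has_derivative_vel: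
  assumes "t \<ge> 0"
  shows "(vel t has_derivative (\<lambda>h. - cell_deriv x h
    + (cos (back_flow t x $ 1) * back_flow_deriv t x h $ 1) *\<^sub>R axis 3 1)) (at x)"
proof -
  have "((\<lambda>x. back_flow t x $ 1) has_derivative (\<lambda>h. back_flow_deriv t x h $ 1)) (at x)"
    by (rule bounded_linear.has_derivative[OF bounded_linear_vec_nth cell.has_derivative_flow[OF assms]])
  then show ?thesis
    unfolding vel_def[abs_def]
    by (auto intro!: derivative_eq_intros cell.deriv_v simp: mult.commute)
qed

lemmas partial_vel = partial_eq[OF has_derivative_vel]

text \<open>By \<open>flow_deriv_v\<close> the time derivative of the flow is also its spatial
  derivative along \<open>cell x\<close>. In this form it is the transport equation for the third
  component.\<close>

lemma vel_time_derivative: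
  assumes "t \<ge> 0"
  shows "((\<lambda>s. vel s x) has_vector_derivative
    (cos (back_flow t x $ 1) * back_flow_deriv t x (cell x) $ 1) *\<^sub>R axis 3 1) (at t within {0..})"
proof -
  have "((\<lambda>s. back_flow s x $ 1) has_vector_derivative back_flow_deriv t x (cell x) $ 1) (at t within {0..})"
    using bounded_linear.has_vector_derivative[OF bounded_linear_vec_nth cell.flow_ode[OF assms]]
    unfolding cell.flow_deriv_v[OF assms] .
  then have "((\<lambda>s. back_flow s x $ 1) has_real_derivative back_flow_deriv t x (cell x) $ 1) (at t within {0..})"
    by (simp add: has_real_derivative_iff_has_vector_derivative)
  then have "((\<lambda>s. sin (back_flow s x $ 1)) has_real_derivative
      cos (back_flow t x $ 1) * back_flow_deriv t x (cell x) $ 1) (at t within {0..})"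
    by (auto intro!: derivative_eq_intros)
  then have "((\<lambda>s. - cell x + sin (back_flow s x $ 1) *\<^sub>R axis 3 1) has_vector_derivative
      0 + (cos (back_flow t x $ 1) * back_flow_deriv t x (cell x) $ 1) *\<^sub>R axis 3 1) (at t within {0..})"
    by (intro has_vector_derivative_add has_vector_derivative_const
        bounded_linear.has_vector_derivative[OF bounded_linear_scaleR_left])
      (simp add: has_real_derivative_iff_has_vector_derivative)
  then show ?thesis by (simp add: vel_def[abs_def])
qed

lemma time_deriv_vel:
  assumes "t \<ge> 0"
  shows "time_deriv vel t x = (cos (back_flow t x $ 1) * back_flow_deriv t x (cell x) $ 1) *\<^sub>R axis 3 1"
  unfolding time_deriv_def
proof (rule vector_derivative_within[OF _ vel_time_derivative[OF assms]])
  \<comment> \<open>A one-sided derivative is unique at a limit point of the half-line, and this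
    argument includes t = 0.\<close>
  have "t islimpt {t<..<t + 1}"
    by (simp add: islimpt_greaterThanLessThan1)
  then have "t islimpt {0..}"
    by (rule islimpt_subset) (use assms in auto)
  then show "at t within {0..} \<noteq> bot"
    by (simp add: trivial_limit_within)
qed

section \<open>Pressure, advection and incompressibility\<close>

text \<open>This is (cos (2 x1) + cos (2 x2)) / 4; the phase pi / 2 turns the sines into
  cosines.\<close>

definition pressure :: "real ^ 3 \<Rightarrow> real" where
  "pressure = modes [(vector [2, 0, 0], pi / 2, 1/4), (vector [0, 2, 0], pi / 2, 1/4)]"

lemma pressure_periodic: "periodic pressure"
proof -
  have p: "pressure x = (cos (2 * x $ 1) + cos (2 * x $ 2)) / 4" for x
    by (simp add: pressure_def inner_vector_3 sin_add)
  have per: "cos (2 * y + 4 * pi) = cos (2 * y)" for y :: real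
    using cos_periodic[of "2 * y"] cos_periodic[of "2 * y + 2 * pi"] by (simp add: algebra_simps)
  show ?thesis
    unfolding periodic_def
  proof (intro allI)
    fix x i show "pressure (x + (2 * pi) *\<^sub>R axis i 1) = pressure x"
      using exhaust_3[of i] by (auto simp: p per axis_nth)
  qed
qed

text \<open>The identity sin^2 + cos^2 = 1 leaves in each component a function of its own coordinate
  alone, so the planar advection term is a gradient.\<close>

lemma cell_deriv_cell:
  "cell_deriv x (cell x) = vector [sin (x $ 1) * cos (x $ 1), sin (x $ 2) * cos (x $ 2), 0]"
proof -
  have "cell_deriv x (cell x) $ 1 = sin (x $ 1) * cos (x $ 1) * ((sin (x $ 2))\<^sup>2 + (cos (x $ 2))\<^sup>2)"
    "cell_deriv x (cell x) $ 2 = sin (x $ 2) * cos (x $ 2) * ((sin (x $ 1))\<^sup>2 + (cos (x $ 1))\<^sup>2)"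
    by (simp_all only: cell_deriv_nth cell_nth, algebra+)
  then show ?thesis
    by (simp add: vec_eq_iff forall_3 cell_deriv_nth(3) vector_3)
qed

lemma grad_pressure: "grad pressure x = - cell_deriv x (cell x)"
  by (simp add: vec_eq_iff forall_3 cell_deriv_cell vector_3 grad_def pressure_def
      partial_eq[OF has_derivative_modes] inner_vector_3 axis_nth cos_add sin_double)

lemma vec_3_eq_sum_axis: "(\<Sum>i\<in>UNIV. x $ i *\<^sub>R axis i 1) = (x :: real ^ 3)"
  by (simp add: vec_eq_iff forall_3 sum_3 axis_nth)

text \<open>By linearity the sum over partial derivatives is one directional derivative along the
  velocity. Its vertical part vanishes, since the velocity does not change in the third
  direction.\<close>

lemma advect_vel:
  assumes "t \<ge> 0"
  shows "advect (vel t) (vel t) x = cell_deriv x (cell x)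
    - (cos (back_flow t x $ 1) * back_flow_deriv t x (cell x) $ 1) *\<^sub>R axis 3 1"
proof -
  let ?D = "\<lambda>h. - cell_deriv x h + (cos (back_flow t x $ 1) * back_flow_deriv t x h $ 1) *\<^sub>R axis 3 1"
  have lin: "linear ?D"
    by (rule has_derivative_linear[OF has_derivative_vel[OF assms]])
  have "advect (vel t) (vel t) x = ?D (\<Sum>i\<in>UNIV. vel t x $ i *\<^sub>R axis i 1)"
    unfolding advect_def partial_vel[OF assms] by (simp only: linear_sum[OF lin] linear_cmul[OF lin])
  also have "\<dots> = ?D (- cell x + sin (back_flow t x $ 1) *\<^sub>R axis 3 1)"
    by (simp only: vec_3_eq_sum_axis vel_def)
  also have "\<dots> = - ?D (cell x) + sin (back_flow t x $ 1) *\<^sub>R ?D (axis 3 1)"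
    by (simp only: linear_add[OF lin] linear_neg[OF lin] linear_cmul[OF lin])
  also have "?D (axis 3 1) = 0"
    by (simp add: back_flow_deriv_axis_3[OF assms] vec_eq_iff forall_3 cell_deriv_nth axis_nth)
  finally show ?thesis by simp
qed

text \<open>The two planar diagonal entries cancel, and the third component is constant in
  x3.\<close>

lemma div_vel: "t \<ge> 0 \<Longrightarrow> div_field (vel t) x = 0"
  by (simp add: div_field_def partial_vel sum_3 cell_deriv_nth axis_nth back_flow_deriv_axis_3)

section \<open>Regularity and the Euler system\<close>

lemma vel_C1: "C1_spacetime vel"
  unfolding C1_spacetime_def
proof (intro conjI allI impI)
  fix t :: real assume t: "t \<ge> 0"
  show "periodic (vel t)"
    \<comment> \<open>A shift by 2 pi along an axis moves the backward position by the same vector;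
      the outer sine absorbs it.\<close>
    unfolding periodic_def vel_def cell.flow_add_period[OF cell_periodic t] cell_periodic
    by (auto simp: axis_nth)
  fix x
  show "vel t differentiable (at x)"
    using has_derivative_vel[OF t] by (auto simp: differentiable_def)
  show "(\<lambda>s. vel s x) differentiable (at t within {0..})"
    using vel_time_derivative[OF t] by (auto simp: differentiable_def has_vector_derivative_def)
next
  have flow: "continuous_on ({0..} \<times> UNIV) (\<lambda>p. back_flow (fst p) (snd p))"
    and flow_deriv: "continuous_on ({0..} \<times> UNIV) (\<lambda>p. back_flow_deriv (fst p) (snd p))"
    using cell.continuous_on_flow cell.continuous_on_flow_deriv by (simp_all add: split_beta)
  have cell: "continuous_on ({0..} \<times> UNIV) (\<lambda>p::real \<times> (real ^ 3). cell (snd p))"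
    by (intro cell.continuous_on_v continuous_intros)
  have cell_deriv: "continuous_on ({0..} \<times> UNIV) (\<lambda>p::real \<times> (real ^ 3). cell_deriv (snd p))"
    by (intro cell.continuous_on_Dv continuous_intros)
  show "continuous_on ({0..} \<times> UNIV) (\<lambda>(t, x). vel t x)"
    unfolding vel_def split_beta by (intro continuous_intros flow cell)
  have "continuous_on ({0..} \<times> UNIV) (\<lambda>p. - cell_deriv (snd p) (axis i 1)
    + (cos (back_flow (fst p) (snd p) $ 1) * back_flow_deriv (fst p) (snd p) (axis i 1) $ 1) *\<^sub>R axis 3 1)" for i
    by (intro continuous_intros flow flow_deriv cell_deriv)
  then show "continuous_on ({0..} \<times> UNIV) (\<lambda>(t, x). partial i (vel t) x)" for i
    by (rule continuous_on_eq) (auto simp: partial_vel)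
  have "continuous_on ({0..} \<times> UNIV) (\<lambda>p. (cos (back_flow (fst p) (snd p) $ 1) *
      back_flow_deriv (fst p) (snd p) (cell (snd p)) $ 1) *\<^sub>R (axis 3 1 :: real ^ 3))"
    by (intro continuous_intros flow flow_deriv cell)
  then show "continuous_on ({0..} \<times> UNIV) (\<lambda>(t, x). time_deriv vel t x)"
    by (rule continuous_on_eq) (auto simp: time_deriv_vel)
qed

lemma vel_smooth_initial: "smooth_torus (vel 0)"
proof -
  \<comment> \<open>The flow is the identity at time 0, so the initial velocity is a trigonometric
    polynomial: the negated cell modes and sin x1 in the third component.\<close>
  have "vel 0 = modes [(vector [1, 1, 0], 0, vector [-1/2, 1/2, 0]),
      (vector [1, -1, 0], 0, vector [-1/2, -1/2, 0]), (axis 1 1, 0, axis 3 1)]"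
    unfolding vel_def[abs_def] cell.flow_0
    by (simp add: fun_eq_iff vec_eq_iff forall_3 cell_def inner_vector_3 vector_3 inner_axis' axis_nth)
  then show ?thesis
    using vel_C1 Ck_modes by (auto simp: smooth_torus_def Ck_torus_def C1_spacetime_def)
qed

text \<open>The pressure gradient cancels the planar part of the advection, and the time derivative
  cancels its vertical part.\<close>

lemma vel_euler: "global_strong_euler_solution (vel 0) vel"
  unfolding global_strong_euler_solution_def
proof (intro conjI exI[of _ "\<lambda>_. pressure"] allI impI)
  fix t :: real assume t: "t \<ge> 0"
  show "Ck_torus 1 pressure"
    unfolding Ck_torus_def using pressure_periodic Ck_modes unfolding pressure_def by blast
  show "time_deriv vel t x + advect (vel t) (vel t) x + grad pressure x = 0" for x
    by (simp only: time_deriv_vel[OF t] advect_vel[OF t] grad_pressure) simp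
  show "div_field (vel t) x = 0" for x
    by (rule div_vel[OF t])
qed (simp_all add: vel_C1)

section \<open>Growth of the vorticity\<close>

text \<open>The second vorticity component is the x3-derivative of u1, which is 0, minus the
  x1-derivative of u3. At the origin the latter is cos 0 times exp t.\<close>

lemma curl_vel_origin:
  assumes "t \<ge> 0"
  shows "exp t \<le> norm (curl (vel t) 0)"
proof -
  have "curl (vel t) 0 $ 2 = - exp t"
    by (simp add: curl_def vector_3 partial_vel[OF assms] cell_deriv_nth axis_nth
        cell.flow_fixpoint[OF cell_0 assms] back_flow_deriv_origin[OF assms])
  then show ?thesis
    using component_le_norm_cart[of "curl (vel t) 0" 2] by simp
qed

lemma continuous_on_curl_vel:
  assumes "t \<ge> 0"
  shows "continuous_on UNIV (curl (vel t))"
proof -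
  have "continuous_on ({0..} \<times> UNIV) (\<lambda>(t, x). partial i (vel t) x)" for i
    using vel_C1 by (simp add: C1_spacetime_def)
  from continuous_on_compose2[OF this, where f = "Pair t" and s = UNIV]
  have partials: "continuous_on UNIV (\<lambda>x. partial i (vel t) x $ j)" for i j
    using assms by (intro continuous_on_component) (auto simp: continuous_on_Pair)
  have "continuous_on UNIV (\<lambda>x. curl (vel t) x $ i)" for i
    using exhaust_3[of i] by (auto simp: curl_def vector_3 intro!: continuous_on_diff partials)
  then show ?thesis
    using continuous_on_vec_lambda[of UNIV "\<lambda>i x. curl (vel t) x $ i"] by simp
qed

text \<open>Continuity of the vorticity turns its value at the origin into a bound on the essential
  supremum, although the origin is a corner of the fundamental cell.\<close>

lemma vorticity_growth:
  assumes "t \<ge> 0"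
  shows "ereal (exp t) \<le> Linf_norm (curl (vel t))"
proof -
  have "ereal (norm (curl (vel t) 0)) \<le> Linf_norm (curl (vel t))"
    unfolding Linf_norm_def
    by (rule le_esssup_cbox)
      (use pi_gt_zero in \<open>auto intro!: continuous_on_norm continuous_on_curl_vel assms
        simp: mem_box_cart interval_eq_empty_cart simp flip: not_less\<close>)
  then show ?thesis
    using curl_vel_origin[OF assms] by (meson ereal_less_eq(3) order.trans)
qed

theorem proposition1p4:
  shows "\<exists>u0 :: real ^ 3 \<Rightarrow> real ^ 3. smooth_torus u0 \<and>
    (\<exists>u :: real \<Rightarrow> real ^ 3 \<Rightarrow> real ^ 3. global_strong_euler_solution u0 u \<and>
      (\<forall>t>0. Linf_norm (curl (u t)) \<ge> ereal (exp t)))"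
  using vel_smooth_initial vel_euler vorticity_growth by (meson less_imp_le)

end
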